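(* Let $n\ge5$, $V=\{0,\dots,n-1\}$, and let $p:V\times V\to[0,1]$ be a Markov kernel (possibly non-reversible) with $p(i,j)>0$ if and only if $j\in\{i+1\bmod n,\ i-1\bmod n\}$. Then there exists a general path distance $d$ on the cycle $C_n=(V,p)$ such that the Ollivier curvature $\kappa(i,i+1\bmod n)$ is the same for all $i$; such a distance is unique up to multiplication by a positive constant; and its (constant) Ollivier curvature is non-negative.
   Context: The graph structure is $i\sim j$ iff $p(i,j)>0$ (the $n$-cycle). A general path distance is a symmetric $d:V\times V\to[0,\infty)$ with $d(x,y)=0$ iff $x=y$ and $d(x,y)=\inf\{\sum_kd(x_{k-1},x_k): x=x_0\sim\dots\sim x_m=y\}$. Laplacian $\Delta f(x)=\sum_yp(x,y)(f(y)-f(x))$; $\nabla_{xy}f=(f(x)-f(y))/d(x,y)$; Ollivier curvature for $x\ne y$: $\kappa(x,y)=\inf\{\nabla_{xy}\Delta f:\nabla_{yx}f=1,\sup_{u\ne v}|\nabla_{uv}f|=1\}$. *)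

theory Defs
  imports Complex_Main
begin

definition markov_kernel :: "'a set \<Rightarrow> ('a \<Rightarrow> 'a \<Rightarrow> real) \<Rightarrow> bool" where
  "markov_kernel V p \<longleftrightarrow>
     (\<forall>x\<in>V. \<forall>y\<in>V. 0 \<le> p x y \<and> p x y \<le> 1) \<and> (\<forall>x\<in>V. (\<Sum>y\<in>V. p x y) = 1)"

definition adjacent :: "('a \<Rightarrow> 'a \<Rightarrow> real) \<Rightarrow> 'a \<Rightarrow> 'a \<Rightarrow> bool" where
  "adjacent p x y \<longleftrightarrow> p x y > 0"

definition path_lengths ::
  "'a set \<Rightarrow> ('a \<Rightarrow> 'a \<Rightarrow> real) \<Rightarrow> ('a \<Rightarrow> 'a \<Rightarrow> real) \<Rightarrow> 'a \<Rightarrow> 'a \<Rightarrow> real set" where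
  "path_lengths V p d x y =
     {\<Sum>k<m. d (w k) (w (Suc k)) | (w :: nat \<Rightarrow> 'a) (m :: nat).
        w 0 = x \<and> w m = y \<and> (\<forall>k\<le>m. w k \<in> V) \<and> (\<forall>k<m. adjacent p (w k) (w (Suc k)))}"

text \<open>The infimum is the real one, which has no meaning for the empty set; the definition is
  meant for graphs in which any two vertices are joined by a path. Values of \<^term>\<open>d\<close> outside
  \<^term>\<open>V \<times> V\<close> are irrelevant here and in all notions below.\<close>

definition general_path_distance ::
  "'a set \<Rightarrow> ('a \<Rightarrow> 'a \<Rightarrow> real) \<Rightarrow> ('a \<Rightarrow> 'a \<Rightarrow> real) \<Rightarrow> bool" where
  "general_path_distance V p d \<longleftrightarrow>
     (\<forall>x\<in>V. \<forall>y\<in>V. 0 \<le> d x y \<and> d x y = d y x \<and> (d x y = 0 \<longleftrightarrow> x = y) \<and>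
        d x y = Inf (path_lengths V p d x y))"

definition laplacian :: "'a set \<Rightarrow> ('a \<Rightarrow> 'a \<Rightarrow> real) \<Rightarrow> ('a \<Rightarrow> real) \<Rightarrow> 'a \<Rightarrow> real" where
  "laplacian V p f x = (\<Sum>y\<in>V. p x y * (f y - f x))"

definition gradient :: "('a \<Rightarrow> 'a \<Rightarrow> real) \<Rightarrow> 'a \<Rightarrow> 'a \<Rightarrow> ('a \<Rightarrow> real) \<Rightarrow> real" where
  "gradient d x y f = (f x - f y) / d x y"

text \<open>For finite \<^term>\<open>V\<close> and a metric \<^term>\<open>d\<close>, the supremum is over a finite set, and for
  distinct \<^term>\<open>x\<close>, \<^term>\<open>y\<close> in \<^term>\<open>V\<close> the infimum is over a nonempty set bounded below.\<close>

definition ollivier_curvature ::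
  "'a set \<Rightarrow> ('a \<Rightarrow> 'a \<Rightarrow> real) \<Rightarrow> ('a \<Rightarrow> 'a \<Rightarrow> real) \<Rightarrow> 'a \<Rightarrow> 'a \<Rightarrow> real" where
  "ollivier_curvature V p d x y =
     Inf {gradient d x y (laplacian V p f) | f.
            gradient d y x f = 1 \<and>
            Sup {\<bar>gradient d u v f\<bar> | u v. u \<in> V \<and> v \<in> V \<and> u \<noteq> v} = 1}"

definition constant_curvature_distance ::
  "nat \<Rightarrow> (nat \<Rightarrow> nat \<Rightarrow> real) \<Rightarrow> (nat \<Rightarrow> nat \<Rightarrow> real) \<Rightarrow> bool" where
  "constant_curvature_distance n p d \<longleftrightarrow>
     general_path_distance {..<n} p d \<and>
     (\<exists>K. \<forall>i<n. ollivier_curvature {..<n} p d i ((i + 1) mod n) = K)"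

end

theory Submission
  imports Defs "HOL-Analysis.Analysis"
begin

text \<open>
  A general path distance on the cycle is determined by its edge weights \<open>w j = d j (j + 1)\<close>, which
  are positive with no weight exceeding the sum of the others. Passing from \<open>f\<close> to its edge differences
  \<open>g j = f (j + 1) - f j\<close>, the curvature becomes \<open>4 - T w i / w i\<close>, where \<open>T w i\<close> is the maximum of
  the \<open>i\<close>-th edge difference of \<open>4 f + \<Delta> f\<close> subject to \<open>\<bar>g\<bar> \<le> w\<close>. Linear programming duality (a weighted
  median) turns \<open>T\<close> into a minimum of linear forms with nonnegative coefficients, so distances of constant
  curvature correspond to positive eigenvectors of a monotone homogeneous map.

  Existence is nonlinear Perron--Frobenius theory. For uniqueness, let \<open>c\<close> be the largest constant with
  \<open>c v \<le> u\<close> for two eigenvectors. The set of indices with equality is closed under the dependencies of \<open>T\<close>,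
  which forces its complement to have at most two elements; the same holds with \<open>u\<close> and \<open>v\<close> exchanged,
  and for \<open>n \<ge> 5\<close> the two equality sets must meet. Finally, the matrix taking \<open>g\<close> to the edge differences of \<open>4 f + \<Delta> f\<close> has column sums \<open>4\<close>,
  so the eigenvalue is at most \<open>4\<close> and the curvature is nonnegative.
\<close>

section \<open>Weighted medians and duality\<close>

lemma continuous_on_Min_image:
  fixes f :: "'k \<Rightarrow> 'a::topological_space \<Rightarrow> real"
  assumes "finite K" "K \<noteq> {}" "\<And>k. k \<in> K \<Longrightarrow> continuous_on S (f k)"
  shows "continuous_on S (\<lambda>x. Min ((\<lambda>k. f k x) ` K))"
  using assms
proof (induction K rule: finite_ne_induct)
  case (singleton k)
  then show ?case by simp
next
  case (insert k K)
  then have "continuous_on S (\<lambda>x. min (f k x) (Min ((\<lambda>k. f k x) ` K)))"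
    by (intro continuous_on_min) auto
  then show ?case using insert by simp
qed

text \<open>Among the indices satisfying the first inequality, take one with least value
  \<open>a k\<close>: the next smaller value violates it, and that violation is the second
  inequality for \<open>k\<close>.\<close>

lemma weighted_median_exists:
  fixes a w :: "'a \<Rightarrow> real"
  assumes "finite J" "J \<noteq> {}" and w: "\<And>j. j \<in> J \<Longrightarrow> 0 \<le> w j"
  obtains k where "k \<in> J"
    "(\<Sum>j | j \<in> J \<and> a k < a j. w j) \<le> (\<Sum>j | j \<in> J \<and> a j \<le> a k. w j)"
    "(\<Sum>j | j \<in> J \<and> a j < a k. w j) \<le> (\<Sum>j | j \<in> J \<and> a k \<le> a j. w j)"
proof -
  define S where "S = {k \<in> J. (\<Sum>j | j \<in> J \<and> a k < a j. w j) \<le> (\<Sum>j | j \<in> J \<and> a j \<le> a k. w j)}"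
  have "Max (a ` J) \<in> a ` J" using assms(1,2) by simp
  then obtain t where "t \<in> J" "a t = Max (a ` J)" by fastforce
  then have t: "t \<in> J" "\<And>j. j \<in> J \<Longrightarrow> a j \<le> a t" using assms(1) by auto
  have "{j. j \<in> J \<and> a t < a j} = {}" using t by force
  then have "t \<in> S" unfolding S_def using t(1) w by (auto intro!: sum_nonneg simp del: Collect_empty_eq)
  then have S: "finite S" "S \<noteq> {}" using assms(1) by (auto simp: S_def)
  have "Min (a ` S) \<in> a ` S" using S by simp
  then obtain k where "k \<in> S" "a k = Min (a ` S)" by fastforce
  then have k: "k \<in> S" "\<And>j. j \<in> S \<Longrightarrow> a k \<le> a j" using S by auto
  have "(\<Sum>j | j \<in> J \<and> a j < a k. w j) \<le> (\<Sum>j | j \<in> J \<and> a k \<le> a j. w j)"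
  proof (cases "{j \<in> J. a j < a k} = {}")
    case True
    then show ?thesis using w by (auto intro!: sum_nonneg simp del: Collect_empty_eq)
  next
    case False
    let ?B = "{j \<in> J. a j < a k}"
    have fB: "finite ?B" using assms(1) by simp
    have "Max (a ` ?B) \<in> a ` ?B" using fB False by (intro Max_in) auto
    then obtain l where "l \<in> ?B" "a l = Max (a ` ?B)" by fastforce
    then have l: "l \<in> ?B" "\<And>j. j \<in> ?B \<Longrightarrow> a j \<le> a l" using fB by (auto intro: Max_ge)
    have "l \<notin> S" using k(2) l(1) by force
    then have "(\<Sum>j | j \<in> J \<and> a l < a j. w j) > (\<Sum>j | j \<in> J \<and> a j \<le> a l. w j)"
      using l(1) by (auto simp: S_def)
    moreover have "{j. j \<in> J \<and> a l < a j} = {j. j \<in> J \<and> a k \<le> a j}"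
      using l by force
    moreover have "{j. j \<in> J \<and> a j \<le> a l} = {j. j \<in> J \<and> a j < a k}"
      using l by force
    ultimately show ?thesis by simp
  qed
  then show ?thesis using that k(1) by (auto simp: S_def)
qed

text \<open>Complementary slackness: \<open>g\<close> saturates its bound with the sign of
  \<open>a j - a k\<close>, and the level set of the median value absorbs the remaining
  imbalance.\<close>

lemma weighted_median_dual:
  fixes a w :: "'a \<Rightarrow> real"
  assumes J: "finite J" "J \<noteq> {}" and w: "\<And>j. j \<in> J \<Longrightarrow> 0 \<le> w j"
  obtains k g where "k \<in> J" "\<And>j. j \<in> J \<Longrightarrow> \<bar>g j\<bar> \<le> w j" "(\<Sum>j\<in>J. g j) = 0"
    "(\<Sum>j\<in>J. a j * g j) = (\<Sum>j\<in>J. \<bar>a j - a k\<bar> * w j)"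
    "\<And>j. j \<in> J \<Longrightarrow> a k < a j \<Longrightarrow> g j = w j"
    "\<And>j. j \<in> J \<Longrightarrow> a j < a k \<Longrightarrow> g j = - w j"
proof -
  obtain k where k: "k \<in> J"
    "(\<Sum>j | j \<in> J \<and> a k < a j. w j) \<le> (\<Sum>j | j \<in> J \<and> a j \<le> a k. w j)"
    "(\<Sum>j | j \<in> J \<and> a j < a k. w j) \<le> (\<Sum>j | j \<in> J \<and> a k \<le> a j. w j)"
    by (rule weighted_median_exists[OF J, where w = w and a = a]) (use w in auto)
  define U where "U = (\<Sum>j | j \<in> J \<and> a k < a j. w j)"
  define D where "D = (\<Sum>j | j \<in> J \<and> a j < a k. w j)"
  define E where "E = (\<Sum>j | j \<in> J \<and> a j = a k. w j)"
  have "{j. j \<in> J \<and> a j \<le> a k} = {j. j \<in> J \<and> a j < a k} \<union> {j. j \<in> J \<and> a j = a k}" by auto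
  then have DE: "(\<Sum>j | j \<in> J \<and> a j \<le> a k. w j) = D + E"
    unfolding D_def E_def using J(1) by (simp only:) (rule sum.union_disjoint, auto)
  have "{j. j \<in> J \<and> a k \<le> a j} = {j. j \<in> J \<and> a k < a j} \<union> {j. j \<in> J \<and> a j = a k}" by auto
  then have UE: "(\<Sum>j | j \<in> J \<and> a k \<le> a j. w j) = U + E"
    unfolding U_def E_def using J(1) by (simp only:) (rule sum.union_disjoint, auto)
  have DU: "\<bar>D - U\<bar> \<le> E" using k(2,3) DE UE by (simp add: U_def D_def)
  \<comment> \<open>If \<open>E = 0\<close> then \<open>D = U\<close> by \<open>DU\<close>, so the
    value 0 of the division by zero is still the right fraction.\<close>
  define \<tau> where "\<tau> = (D - U) / E"
  have \<tau>: "\<bar>\<tau>\<bar> \<le> 1" "\<tau> * E = D - U" using DU by (auto simp: \<tau>_def divide_simps)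
  define g where "g j = (if a k < a j then w j else if a j < a k then - w j else \<tau> * w j)" for j
  have g1: "\<bar>g j\<bar> \<le> w j" if "j \<in> J" for j
    using \<tau>(1) w[OF that] mult_right_mono[of "\<bar>\<tau>\<bar>" 1 "w j"] by (auto simp: g_def abs_mult)
  have "(\<Sum>j\<in>J. g j) = (\<Sum>j\<in>J. (if a k < a j then w j else 0) - (if a j < a k then w j else 0)
      + \<tau> * (if a j = a k then w j else 0))"
    by (rule sum.cong) (auto simp: g_def)
  also have "\<dots> = U - D + \<tau> * E"
    using J(1) by (simp add: sum.distrib sum_subtractf sum_distrib_left[symmetric] U_def D_def E_def
      sum.inter_filter)
  finally have g0: "(\<Sum>j\<in>J. g j) = 0" using \<tau> by simp
  have "(\<Sum>j\<in>J. a j * g j) = (\<Sum>j\<in>J. (a j - a k) * g j) + a k * (\<Sum>j\<in>J. g j)"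
    by (simp add: sum_distrib_left sum.distrib[symmetric] algebra_simps)
  also have "\<dots> = (\<Sum>j\<in>J. \<bar>a j - a k\<bar> * w j)"
    unfolding g0 by (auto simp: g_def algebra_simps intro!: sum.cong)
  finally show ?thesis using that[of k g] k(1) g1 g0 by (auto simp: g_def)
qed

section \<open>Eigenvectors of monotone homogeneous maps\<close>

text \<open>Extension by zero puts vectors of length \<open>n\<close> into a function space, where
  Tychonoff's theorem gives compactness.\<close>

definition simplex_on :: "nat \<Rightarrow> (nat \<Rightarrow> real) set" where
  "simplex_on n = {w. (\<forall>i. 0 \<le> w i \<and> w i \<le> 1) \<and> (\<forall>i\<ge>n. w i = 0) \<and> (\<Sum>i<n. w i) = 1}"

lemma compact_simplex_on: "compact (simplex_on n)"
proof -
  have "compactin (product_topology (\<lambda>_. euclidean) UNIV) (PiE (UNIV :: nat set) (\<lambda>_. {0..1::real}))"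
    by (simp add: compactin_PiE)
  then have K: "compact (PiE (UNIV :: nat set) (\<lambda>_. {0..1::real}))"
    by (simp add: euclidean_product_topology)
  have "closed {w :: nat \<Rightarrow> real. (\<Sum>i<n. w i) = 1}"
    by (intro closed_Collect_eq continuous_intros)
       (auto intro: continuous_on_product_then_coordinatewise)
  moreover have "closed {w :: nat \<Rightarrow> real. \<forall>i\<ge>n. w i = 0}"
    by (intro closed_Collect_all closed_Collect_imp closed_Collect_eq continuous_intros)
       (auto intro: continuous_on_product_then_coordinatewise)
  ultimately have "compact (PiE (UNIV :: nat set) (\<lambda>_. {0..1::real}) \<inter>
      ({w. (\<Sum>i<n. w i) = 1} \<inter> {w. \<forall>i\<ge>n. w i = 0}))"
    using K by (intro compact_Int_closed closed_Int)
  moreover have "PiE (UNIV :: nat set) (\<lambda>_. {0..1::real}) \<inter>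
      ({w. (\<Sum>i<n. w i) = 1} \<inter> {w. \<forall>i\<ge>n. w i = 0}) = simplex_on n"
    by (auto simp: simplex_on_def PiE_def Pi_def extensional_def)
  ultimately show ?thesis by simp
qed

lemma continuous_on_coordinate_product:
  "continuous_on S (\<lambda>z :: real \<times> (nat \<Rightarrow> real). fst z * snd z i)"
proof -
  have "continuous_on S (\<lambda>z :: real \<times> (nat \<Rightarrow> real). snd z i)"
    by (rule continuous_on_product_then_coordinatewise[OF continuous_on_snd[OF continuous_on_id]])
  then show ?thesis by (intro continuous_on_mult continuous_on_fst continuous_on_id)
qed

text \<open>Collatz--Wielandt: the largest \<open>\<mu>\<close> admitting a subeigenvector \<open>\<mu> w \<le> F w\<close> is attained;
  strict monotonicity forces equality there, as otherwise \<open>F w\<close> would do better than \<open>w\<close>.\<close>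

lemma strictly_monotone_eigenvector:
  fixes F :: "(nat \<Rightarrow> real) \<Rightarrow> nat \<Rightarrow> real"
  assumes n: "n > 0"
    and mono: "\<And>u v i. (\<And>j. j < n \<Longrightarrow> 0 \<le> u j) \<Longrightarrow> (\<And>j. j < n \<Longrightarrow> u j \<le> v j) \<Longrightarrow> i < n \<Longrightarrow> F u i \<le> F v i"
    and strict: "\<And>u v i. (\<And>j. j < n \<Longrightarrow> 0 \<le> u j) \<Longrightarrow> (\<And>j. j < n \<Longrightarrow> u j \<le> v j) \<Longrightarrow>
        (\<exists>j<n. u j < v j) \<Longrightarrow> i < n \<Longrightarrow> F u i < F v i"
    and hom: "\<And>c u i. 0 \<le> c \<Longrightarrow> i < n \<Longrightarrow> F (\<lambda>j. c * u j) i = c * F u i"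
    and cont: "\<And>i. i < n \<Longrightarrow> continuous_on UNIV (\<lambda>w. F w i)"
    and one: "\<And>i. i < n \<Longrightarrow> 1 \<le> F (\<lambda>_. 1) i"
  obtains w \<mu> where "w \<in> simplex_on n" "1 \<le> \<mu>" "\<mu> \<le> (\<Sum>i<n. F (\<lambda>_. 1) i)"
    "\<And>i. i < n \<Longrightarrow> F w i = \<mu> * w i"
proof -
  define B where "B = (\<Sum>i<n. F (\<lambda>_. 1) i)"
  define S where "S = ({1..B} \<times> simplex_on n) \<inter> {z. \<forall>i<n. fst z * snd z i \<le> F (snd z) i}"
  have bound: "\<mu> \<le> B" if "w \<in> simplex_on n" "\<And>i. i < n \<Longrightarrow> \<mu> * w i \<le> F w i" for w \<mu>
  proof -
    have "\<mu> = (\<Sum>i<n. \<mu> * w i)" using that(1) by (simp add: simplex_on_def sum_distrib_left[symmetric])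
    also have "\<dots> \<le> (\<Sum>i<n. F (\<lambda>_. 1) i)"
      using that by (intro sum_mono order.trans[OF that(2) mono]) (auto simp: simplex_on_def)
    finally show ?thesis by (simp add: B_def)
  qed
  have "closed {z :: real \<times> (nat \<Rightarrow> real). \<forall>i<n. fst z * snd z i \<le> F (snd z) i}"
  proof -
    have "closed {z :: real \<times> (nat \<Rightarrow> real). fst z * snd z i \<le> F (snd z) i}" if "i < n" for i
      by (intro closed_Collect_le continuous_on_coordinate_product continuous_on_compose2[OF cont[OF that]]
          continuous_on_snd continuous_on_id) simp
    then have "closed (\<Inter>i<n. {z :: real \<times> (nat \<Rightarrow> real). fst z * snd z i \<le> F (snd z) i})"
      by (intro closed_INT) auto
    then show ?thesis by (simp add: INTER_eq lessThan_def Ball_def)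
  qed
  then have S_compact: "compact S" unfolding S_def
    by (intro compact_Int_closed compact_Times compact_simplex_on) auto
  have S_I: "(\<mu>, w) \<in> S" if "w \<in> simplex_on n" "1 \<le> \<mu>" "\<And>i. i < n \<Longrightarrow> \<mu> * w i \<le> F w i" for w \<mu>
    using that bound[OF that(1,3)] by (auto simp: S_def)
  have "S \<noteq> {}"
  proof -
    define u where "u j = (if j < n then 1 / real n else 0)" for j
    have "u \<in> simplex_on n" using n by (auto simp: simplex_on_def u_def)
    moreover have "1 * u i \<le> F u i" if "i < n" for i
    proof -
      have "1 * u i \<le> F (\<lambda>j. (1 / real n) * 1) i"
        using hom[of "1 / real n" i "\<lambda>_. 1"] one[OF that] that by (simp add: u_def divide_simps)
      also have "\<dots> \<le> F u i" by (rule mono) (use that in \<open>auto simp: u_def\<close>)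
      finally show ?thesis .
    qed
    ultimately show ?thesis using S_I[of u 1] by auto
  qed
  then obtain z where z: "z \<in> S" "\<And>y. y \<in> S \<Longrightarrow> fst y \<le> fst z"
    using continuous_attains_sup[OF S_compact _ continuous_on_fst[OF continuous_on_id]] by blast
  obtain \<mu> w where "z = (\<mu>, w)" by (cases z)
  then have w: "w \<in> simplex_on n" "1 \<le> \<mu>" "\<mu> \<le> B" "\<And>i. i < n \<Longrightarrow> \<mu> * w i \<le> F w i"
    and max: "\<And>\<nu> v. (\<nu>, v) \<in> S \<Longrightarrow> \<nu> \<le> \<mu>"
    using z by (force simp: S_def)+
  have w0: "0 \<le> w j" for j using w(1) by (simp add: simplex_on_def)
  have "F w i = \<mu> * w i" if "i < n" for i
  proof (rule ccontr)
    assume "F w i \<noteq> \<mu> * w i"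
    then have ex: "\<exists>i<n. \<mu> * w i < F w i" using w(4)[OF that] that by force
    define v where "v j = (if j < n then F w j else 0)" for j
    have v_ge: "\<mu> * w j \<le> v j" if "j < n" for j using w(4) that by (simp add: v_def)
    have v0: "0 \<le> v j" for j
    proof (cases "j < n")
      case True
      then show ?thesis using v_ge[OF True] w0[of j] w(2) mult_nonneg_nonneg[of \<mu> "w j"] by linarith
    qed (simp add: v_def)
    define s where "s = (\<Sum>j<n. v j)"
    have "\<mu> = (\<Sum>j<n. \<mu> * w j)" using w(1) by (simp add: simplex_on_def sum_distrib_left[symmetric])
    also have "\<dots> \<le> s" unfolding s_def by (rule sum_mono) (use v_ge in auto)
    finally have s: "s > 0" using w(2) by linarith
    have vs: "v j \<le> s" if "j < n" for j
      unfolding s_def using v0 that by (intro member_le_sum) auto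
    \<comment> \<open>One strict inequality in \<open>\<mu> * w j \<le> F w j\<close> becomes strict
      at every index after applying \<open>F\<close> once more.\<close>
    have gap: "\<mu> * v j < F v j" if j: "j < n" for j
    proof -
      have "\<mu> * v j = F (\<lambda>l. \<mu> * w l) j" using hom[of \<mu> j w] w(2) j by (simp add: v_def)
      also have "\<dots> < F v j"
        by (rule strict) (use v_ge w0 w(2) ex j in \<open>auto simp: v_def\<close>)
      finally show ?thesis .
    qed
    define \<delta> where "\<delta> = Min ((\<lambda>j. F v j - \<mu> * v j) ` {..<n})"
    have "\<delta> > 0" unfolding \<delta>_def using n gap by (subst Min_gr_iff) auto
    have \<delta>: "\<delta> \<le> F v j - \<mu> * v j" if "j < n" for j unfolding \<delta>_def using that by (intro Min_le) auto
    \<comment> \<open>Since \<open>v j \<le> s\<close>, raising \<open>\<mu>\<close> by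
      \<open>\<delta> / s\<close> uses up at most the slack \<open>\<delta>\<close> at each
      index.\<close>
    define \<nu> where "\<nu> = \<mu> + \<delta> / s"
    define u where "u = (\<lambda>j. (1 / s) * v j)"
    have "(\<Sum>j<n. u j) = 1"
      using s unfolding u_def sum_distrib_left[symmetric] s_def[symmetric] by simp
    then have "u \<in> simplex_on n"
      using s v0 vs by (auto simp: simplex_on_def u_def v_def divide_simps)
    moreover have "\<nu> * u j \<le> F u j" if j: "j < n" for j
    proof -
      have "\<delta> / s * v j \<le> \<delta>" using vs[OF j] \<open>\<delta> > 0\<close> s
        by (simp add: divide_simps mult_left_mono)
      then have "\<nu> * v j \<le> F v j" using \<delta>[OF j] by (simp add: \<nu>_def algebra_simps)
      then have "(1 / s) * (\<nu> * v j) \<le> (1 / s) * F v j" using s by (intro mult_left_mono) auto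
      also have "\<dots> = F u j" using hom[of "1 / s" j v] s j by (simp add: u_def)
      finally show ?thesis by (simp add: u_def mult_ac)
    qed
    moreover have "\<nu> > \<mu>" using \<open>\<delta> > 0\<close> s by (simp add: \<nu>_def)
    ultimately show False using max[OF S_I[of u \<nu>]] w(2) by force
  qed
  then show ?thesis using that w by (simp add: B_def)
qed

text \<open>The perturbation \<open>F + \<epsilon> (\<Sum>j. w j)\<close> is strictly monotone; let \<open>\<epsilon>\<close> tend to \<open>0\<close>.\<close>

lemma monotone_eigenvector:
  fixes F :: "(nat \<Rightarrow> real) \<Rightarrow> nat \<Rightarrow> real"
  assumes n: "n > 0"
    and mono: "\<And>u v i. (\<And>j. j < n \<Longrightarrow> 0 \<le> u j) \<Longrightarrow> (\<And>j. j < n \<Longrightarrow> u j \<le> v j) \<Longrightarrow> i < n \<Longrightarrow> F u i \<le> F v i"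
    and hom: "\<And>c u i. 0 \<le> c \<Longrightarrow> i < n \<Longrightarrow> F (\<lambda>j. c * u j) i = c * F u i"
    and cont: "\<And>i. i < n \<Longrightarrow> continuous_on UNIV (\<lambda>w. F w i)"
    and one: "\<And>i. i < n \<Longrightarrow> 1 \<le> F (\<lambda>_. 1) i"
  obtains w \<mu> where "w \<in> simplex_on n" "1 \<le> \<mu>" "\<And>i. i < n \<Longrightarrow> F w i = \<mu> * w i"
proof -
  \<comment> \<open>Replacing \<open>\<epsilon> m\<close> by its upper bound 1 gives an eigenvalue
    bound uniform in \<open>m\<close>, which keeps the sequence in a compact set.\<close>
  define B where "B = (\<Sum>i<n. F (\<lambda>_. 1) i + real n)"
  define \<epsilon> where "\<epsilon> m = 1 / real (Suc m)" for m
  have \<epsilon>: "0 < \<epsilon> m" "\<epsilon> m \<le> 1" for m by (auto simp: \<epsilon>_def)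
  have "\<exists>z. z \<in> {1..B} \<times> simplex_on n \<and> (\<forall>i<n. F (snd z) i + \<epsilon> m = fst z * snd z i)" for m
  proof -
    define H where "H w i = F w i + \<epsilon> m * (\<Sum>j<n. w j)" for w i
    obtain w \<mu> where w: "w \<in> simplex_on n" "1 \<le> \<mu>" "\<mu> \<le> (\<Sum>i<n. H (\<lambda>_. 1) i)"
      "\<And>i. i < n \<Longrightarrow> H w i = \<mu> * w i"
    proof (rule strictly_monotone_eigenvector[of n H])
      fix u v :: "nat \<Rightarrow> real" and i
      assume u: "\<And>j. j < n \<Longrightarrow> 0 \<le> u j" "\<And>j. j < n \<Longrightarrow> u j \<le> v j" and i: "i < n"
      have F: "F u i \<le> F v i" using u i by (rule mono)
      have "(\<Sum>j<n. u j) \<le> (\<Sum>j<n. v j)" using u by (intro sum_mono) auto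
      then show "H u i \<le> H v i" unfolding H_def using F \<epsilon>[of m] by (simp add: add_mono)
      assume "\<exists>j<n. u j < v j"
      then have "(\<Sum>j<n. u j) < (\<Sum>j<n. v j)" using u by (intro sum_strict_mono_ex1) auto
      then show "H u i < H v i" unfolding H_def using F \<epsilon>[of m] by (simp add: add_le_less_mono)
    next
      fix c :: real and u i assume "0 \<le> c" "i < n"
      then show "H (\<lambda>j. c * u j) i = c * H u i"
        by (simp add: H_def hom sum_distrib_left[symmetric] algebra_simps)
    next
      fix i assume "i < n"
      then show "continuous_on UNIV (\<lambda>w. H w i)" unfolding H_def
        by (intro continuous_intros cont) (auto intro: continuous_on_product_then_coordinatewise)
    next
      fix i assume "i < n"
      then show "1 \<le> H (\<lambda>_. 1) i" using one[of i] \<epsilon>[of m] by (simp add: H_def add_increasing2)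
    qed (use n in auto)
    have "(\<Sum>i<n. H (\<lambda>_. 1) i) \<le> B" unfolding B_def H_def
      using \<epsilon>(2)[of m] mult_right_mono[OF \<epsilon>(2)[of m], of "real n"] by (intro sum_mono) auto
    \<comment> \<open>On the simplex the coordinates sum to 1, so the perturbation is the constant
      \<open>\<epsilon> m\<close>.\<close>
    then show ?thesis using w by (intro exI[of _ "(\<mu>, w)"]) (auto simp: H_def simplex_on_def)
  qed
  then obtain z where z: "\<And>m. z m \<in> {1..B} \<times> simplex_on n"
    "\<And>m i. i < n \<Longrightarrow> F (snd (z m)) i + \<epsilon> m = fst (z m) * snd (z m) i" by metis
  have "compact ({1..B} \<times> simplex_on n)" by (intro compact_Times compact_simplex_on) auto
  then have "seq_compact ({1..B} \<times> simplex_on n)" by (rule compact_imp_seq_compact)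
  then obtain l r where l: "l \<in> {1..B} \<times> simplex_on n" "strict_mono r" "(z \<circ> r) \<longlonglongrightarrow> l"
    using z(1) unfolding seq_compact_def by metis
  have "F (snd l) i = fst l * snd l i" if i: "i < n" for i
  proof -
    have c1: "continuous_on UNIV (\<lambda>z :: real \<times> (nat \<Rightarrow> real). F (snd z) i)"
      by (rule continuous_on_compose2[OF cont[OF i] continuous_on_snd[OF continuous_on_id]]) simp
    have c2: "continuous_on UNIV (\<lambda>z :: real \<times> (nat \<Rightarrow> real). fst z * snd z i)"
      by (rule continuous_on_coordinate_product)
    have "(\<lambda>m. F (snd (z (r m))) i) \<longlonglongrightarrow> F (snd l) i"
      using continuous_on_tendsto_compose[OF c1 l(3)] by (simp add: o_def)
    moreover have "(\<lambda>m. \<epsilon> (r m)) \<longlonglongrightarrow> 0"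
      using LIMSEQ_subseq_LIMSEQ[OF LIMSEQ_inverse_real_of_nat l(2)]
      by (simp add: \<epsilon>_def o_def inverse_eq_divide)
    ultimately have "(\<lambda>m. F (snd (z (r m))) i + \<epsilon> (r m)) \<longlonglongrightarrow> F (snd l) i + 0"
      by (rule tendsto_add)
    moreover have "(\<lambda>m. fst (z (r m)) * snd (z (r m)) i) \<longlonglongrightarrow> fst l * snd l i"
      using continuous_on_tendsto_compose[OF c2 l(3)] by (simp add: o_def)
    ultimately show ?thesis using z(2)[OF i] by (auto dest: LIMSEQ_unique)
  qed
  then show ?thesis using that[of "snd l" "fst l"] l(1) by auto
qed

section \<open>Random walks on the cycle\<close>

locale cyclic_walk =
  fixes n :: nat and p :: "nat \<Rightarrow> nat \<Rightarrow> real"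
  assumes n5: "5 \<le> n"
    and kernel: "markov_kernel {..<n} p"
    and support: "\<And>i j. i < n \<Longrightarrow> j < n \<Longrightarrow>
           p i j > 0 \<longleftrightarrow> j \<in> {(i + 1) mod n, (i + n - 1) mod n}"
begin

definition nx :: "nat \<Rightarrow> nat" where "nx i = (i + 1) mod n"

definition pv :: "nat \<Rightarrow> nat" where "pv i = (i + n - 1) mod n"

lemma nx_if: "i < n \<Longrightarrow> nx i = (if Suc i = n then 0 else Suc i)"
  by (simp add: nx_def)

lemma pv_if: "i < n \<Longrightarrow> pv i = (if i = 0 then n - 1 else i - 1)"
  unfolding pv_def using n5 by (cases i) auto

lemma nx_less [simp]: "nx i < n" and pv_less [simp]: "pv i < n"
  using n5 by (auto simp: nx_def pv_def)

lemma nx_pv [simp]: "i < n \<Longrightarrow> nx (pv i) = i"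
  and pv_nx [simp]: "i < n \<Longrightarrow> pv (nx i) = i"
  using n5 by (auto simp: nx_if pv_if split: if_splits)

lemma neighbours_distinct:
  assumes "i < n"
  shows "nx i \<noteq> i" "pv i \<noteq> i" "nx i \<noteq> pv i" "nx (nx i) \<noteq> i" "nx (nx i) \<noteq> nx i"
    "nx (nx i) \<noteq> pv i" "nx (nx (nx i)) \<noteq> pv i"
  using n5 assms by (auto simp: nx_if pv_if split: if_splits)

lemma nx_eq_iff: "i < n \<Longrightarrow> j < n \<Longrightarrow> nx i = j \<longleftrightarrow> i = pv j"
  by auto

lemma p_pos_iff: "i < n \<Longrightarrow> j < n \<Longrightarrow> p i j > 0 \<longleftrightarrow> j = nx i \<or> j = pv i"
  using support unfolding nx_def pv_def by blast

lemma adjacent_iff: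
  assumes "i < n" "j < n"
  shows "adjacent p i j \<longleftrightarrow> j = nx i \<or> i = nx j"
  using p_pos_iff[OF assms] assms nx_eq_iff[of j i] by (auto simp: adjacent_def)

lemma p_bounds: "i < n \<Longrightarrow> j < n \<Longrightarrow> 0 \<le> p i j \<and> p i j \<le> 1"
  using kernel by (auto simp: markov_kernel_def)

lemma p_pos: "i < n \<Longrightarrow> 0 < p i (nx i)" "i < n \<Longrightarrow> 0 < p i (pv i)"
  by (simp_all add: p_pos_iff)

lemma sum_shift: "(\<Sum>k<n. h ((m + k) mod n)) = (\<Sum>j<n. h j)"
proof (induction m)
  case (Suc m)
  obtain l where l: "n = Suc l" using n5 by (cases n) auto
  have "(\<Sum>k<n. h ((Suc m + k) mod n)) = (\<Sum>k<l. h ((m + Suc k) mod n)) + h ((m + n) mod n)"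
    by (simp add: l)
  also have "\<dots> = h ((m + 0) mod n) + (\<Sum>k<l. h ((m + Suc k) mod n))" by (simp add: add.commute)
  also have "\<dots> = (\<Sum>k<Suc l. h ((m + k) mod n))"
    by (rule sum.lessThan_Suc_shift[symmetric])
  finally show ?case using Suc l by simp
qed simp

lemma laplacian_cycle:
  assumes "i < n"
  shows "laplacian {..<n} p f i = p i (nx i) * (f (nx i) - f i) - p i (pv i) * (f i - f (pv i))"
proof -
  have "p i j = 0" if "j < n" "j \<noteq> nx i" "j \<noteq> pv i" for j
    using p_pos_iff[OF assms that(1)] that p_bounds[OF assms that(1)] by force
  then have "laplacian {..<n} p f i = (\<Sum>j\<in>{nx i, pv i}. p i j * (f j - f i))"
    unfolding laplacian_def by (intro sum.mono_neutral_right) auto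
  then show ?thesis using neighbours_distinct(3)[OF assms] by (simp add: algebra_simps)
qed

subsection \<open>The operator on edge weights\<close>

text \<open>If \<open>g j = f (j + 1) - f j\<close> are the edge differences of \<open>f\<close>, then \<open>\<Sum>j. M i j * g j\<close> are those
  of \<open>4 f + \<Delta> f\<close>. The shift by \<open>4\<close> makes the diagonal the strictly largest entry of each row.\<close>

definition M :: "nat \<Rightarrow> nat \<Rightarrow> real" where
  "M i j = (if j = i then 4 - p i (nx i) - p (nx i) i else if j = pv i then p i (pv i)
     else if j = nx i then p (nx i) (nx (nx i)) else 0)"

lemma sum_M:
  assumes "i < n"
  shows "(\<Sum>j<n. M i j * g j) = (4 - p i (nx i) - p (nx i) i) * g i + p i (pv i) * g (pv i)
     + p (nx i) (nx (nx i)) * g (nx i)"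
proof -
  have "(\<Sum>j<n. M i j * g j) = (\<Sum>j\<in>{i, pv i, nx i}. M i j * g j)"
    using assms by (intro sum.mono_neutral_right) (auto simp: M_def)
  then show ?thesis using neighbours_distinct[OF assms] by (auto simp: M_def)
qed

lemma sum_M_differences:
  assumes "i < n"
  shows "(\<Sum>j<n. M i j * (f (nx j) - f j)) =
    4 * (f (nx i) - f i) + laplacian {..<n} p f (nx i) - laplacian {..<n} p f i"
  unfolding sum_M[OF assms] laplacian_cycle[OF assms] laplacian_cycle[OF nx_less]
  using assms by (simp add: algebra_simps)

text \<open>The two probabilities subtracted on the diagonal reappear in column \<open>j\<close> in
  the rows \<open>nx j\<close> and \<open>pv j\<close>.\<close>

lemma column_sum_M:
  assumes "j < n"
  shows "(\<Sum>i<n. M i j) = 4"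
proof -
  have "M i j = (if i = j then 4 - p j (nx j) - p (nx j) j else 0) + (if i = nx j then p (nx j) j else 0)
      + (if i = pv j then p j (nx j) else 0)" if "i < n" for i
    using that assms neighbours_distinct[OF assms] neighbours_distinct[OF that] nx_eq_iff[OF assms that]
       nx_eq_iff[OF that assms] by (auto simp: M_def)
  then show ?thesis using assms by (simp add: sum.distrib)
qed

lemma M_nonneg: "i < n \<Longrightarrow> j < n \<Longrightarrow> 0 \<le> M i j"
  using p_bounds[of i "nx i"] p_bounds[of "nx i" i] p_bounds[of i "pv i"]
    p_bounds[of "nx i" "nx (nx i)"] by (auto simp: M_def)

text \<open>Being 4 minus two probabilities, the diagonal entry is at least 2; the others are at
  most 1.\<close>

lemma M_diagonal: "i < n \<Longrightarrow> j < n \<Longrightarrow> j \<noteq> i \<Longrightarrow> M i j + 1 \<le> M i i"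
  using p_bounds[of i "nx i"] p_bounds[of "nx i" i] p_bounds[of i "pv i"]
    p_bounds[of "nx i" "nx (nx i)"] by (auto simp: M_def)

text \<open>By duality, \<open>T w i\<close> is the maximum of \<open>\<Sum>j. M i j * g j\<close> over all \<open>g\<close> with \<open>\<bar>g\<bar> \<le> w\<close> and sum \<open>0\<close>;
  the minimum is attained where \<open>M i k\<close> is a weighted median of row \<open>i\<close>.\<close>

definition T :: "(nat \<Rightarrow> real) \<Rightarrow> nat \<Rightarrow> real" where
  "T w i = Min ((\<lambda>k. \<Sum>j<n. \<bar>M i j - M i k\<bar> * w j) ` {..<n})"

lemma T_le: "k < n \<Longrightarrow> T w i \<le> (\<Sum>j<n. \<bar>M i j - M i k\<bar> * w j)"
  unfolding T_def by (rule Min_le) auto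

lemma T_attained: obtains k where "k < n" "T w i = (\<Sum>j<n. \<bar>M i j - M i k\<bar> * w j)"
proof -
  have "T w i \<in> (\<lambda>k. \<Sum>j<n. \<bar>M i j - M i k\<bar> * w j) ` {..<n}"
    unfolding T_def using n5 by (intro Min_in) (auto simp: lessThan_empty_iff)
  then show ?thesis using that by auto
qed

lemma T_mono:
  assumes "\<And>j. j < n \<Longrightarrow> u j \<le> v j"
  shows "T u i \<le> T v i"
proof -
  obtain k where k: "k < n" "T v i = (\<Sum>j<n. \<bar>M i j - M i k\<bar> * v j)" by (rule T_attained)
  have "T u i \<le> (\<Sum>j<n. \<bar>M i j - M i k\<bar> * u j)" by (rule T_le[OF k(1)])
  also have "\<dots> \<le> T v i" unfolding k(2) using assms by (intro sum_mono mult_left_mono) auto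
  finally show ?thesis .
qed

lemma T_scale:
  assumes "0 \<le> c"
  shows "T (\<lambda>j. c * u j) i = c * T u i"
proof (rule antisym)
  have scale: "(\<Sum>j<n. \<bar>M i j - M i k\<bar> * (c * u j)) = c * (\<Sum>j<n. \<bar>M i j - M i k\<bar> * u j)" for k
    by (simp add: sum_distrib_left mult_ac)
  obtain k where k: "k < n" "T u i = (\<Sum>j<n. \<bar>M i j - M i k\<bar> * u j)" by (rule T_attained)
  show "T (\<lambda>j. c * u j) i \<le> c * T u i"
    using T_le[OF k(1), of "\<lambda>j. c * u j" i] by (simp add: scale k(2))
  obtain l where l: "l < n" "T (\<lambda>j. c * u j) i = (\<Sum>j<n. \<bar>M i j - M i l\<bar> * (c * u j))"
    by (rule T_attained)
  show "c * T u i \<le> T (\<lambda>j. c * u j) i"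
    unfolding l(2) scale using T_le[OF l(1)] assms by (intro mult_left_mono)
qed

lemma T_continuous: "continuous_on UNIV (\<lambda>w. T w i)"
  unfolding T_def using n5
  by (intro continuous_on_Min_image continuous_on_sum continuous_on_mult continuous_on_const
      continuous_on_product_coordinates) (auto simp: lessThan_empty_iff)

lemma T_one: "i < n \<Longrightarrow> 1 \<le> T (\<lambda>_. 1) i"
proof -
  assume i: "i < n"
  obtain k where k: "k < n" "T (\<lambda>_. 1) i = (\<Sum>j<n. \<bar>M i j - M i k\<bar> * 1)" by (rule T_attained)
  \<comment> \<open>Some entry of the row differs from \<open>M i k\<close> by at least 1: the
    diagonal one, or a neighbour of it if \<open>k = i\<close>.\<close>
  define l where "l = (if k = i then nx i else i)"
  have l: "l < n" using i by (simp add: l_def)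
  have "1 \<le> \<bar>M i l - M i k\<bar>"
    using M_diagonal[OF i k(1)] M_diagonal[OF i nx_less, of i] neighbours_distinct(1)[OF i]
    by (auto simp: l_def abs_if)
  also have "\<dots> \<le> (\<Sum>j<n. \<bar>M i j - M i k\<bar>)" using l by (intro member_le_sum) auto
  finally show ?thesis using k(2) by simp
qed

text \<open>Weak duality: as \<open>g\<close> sums to 0, the constant \<open>M i k\<close> can be
  subtracted from the row at no cost.\<close>

lemma T_dual_ge:
  assumes "\<And>j. j < n \<Longrightarrow> \<bar>g j\<bar> \<le> w j" "(\<Sum>j<n. g j) = 0"
  shows "(\<Sum>j<n. M i j * g j) \<le> T w i"
proof -
  obtain k where k: "k < n" "T w i = (\<Sum>j<n. \<bar>M i j - M i k\<bar> * w j)" by (rule T_attained)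
  have "(\<Sum>j<n. M i j * g j) = (\<Sum>j<n. (M i j - M i k) * g j) + M i k * (\<Sum>j<n. g j)"
    by (simp add: sum_distrib_left left_diff_distrib sum_subtractf)
  also have "\<dots> = (\<Sum>j<n. (M i j - M i k) * g j)" using assms(2) by simp
  also have "\<dots> \<le> (\<Sum>j<n. \<bar>M i j - M i k\<bar> * w j)"
  proof (rule sum_mono)
    fix j assume "j \<in> {..<n}"
    then have "\<bar>(M i j - M i k) * g j\<bar> \<le> \<bar>M i j - M i k\<bar> * w j"
      using assms(1) by (auto simp: abs_mult intro!: mult_left_mono)
    then show "(M i j - M i k) * g j \<le> \<bar>M i j - M i k\<bar> * w j" by linarith
  qed
  finally show ?thesis using k(2) by simp
qed

text \<open>Strong duality, from the weighted median of row \<open>i\<close>. The last clause makes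
  the optimal \<open>g\<close> feasible for the curvature, whose definition fixes the difference
  across edge \<open>i\<close>.\<close>

lemma T_dual_attained:
  assumes i: "i < n" and w: "\<And>j. j < n \<Longrightarrow> 0 \<le> w j"
  obtains g where "\<And>j. j < n \<Longrightarrow> \<bar>g j\<bar> \<le> w j" "(\<Sum>j<n. g j) = 0" "(\<Sum>j<n. M i j * g j) = T w i"
    "2 * w i \<le> (\<Sum>j<n. w j) \<Longrightarrow> g i = w i"
proof -
  obtain k g where k: "k \<in> {..<n}" and g: "\<And>j. j \<in> {..<n} \<Longrightarrow> \<bar>g j\<bar> \<le> w j" "(\<Sum>j<n. g j) = 0"
    "(\<Sum>j<n. M i j * g j) = (\<Sum>j<n. \<bar>M i j - M i k\<bar> * w j)"
    "\<And>j. j \<in> {..<n} \<Longrightarrow> M i k < M i j \<Longrightarrow> g j = w j"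
    "\<And>j. j \<in> {..<n} \<Longrightarrow> M i j < M i k \<Longrightarrow> g j = - w j"
    by (rule weighted_median_dual[where J = "{..<n}" and w = w and a = "M i"])
       (use n5 w in \<open>auto simp: lessThan_empty_iff\<close>)
  have "(\<Sum>j<n. M i j * g j) = T w i"
    using T_le[of k w i] k g T_dual_ge[of g w i] by (intro antisym) auto
  moreover have "g i = w i" if le: "2 * w i \<le> (\<Sum>j<n. w j)"
  proof (cases "k = i")
    case True
    \<comment> \<open>A median on the diagonal exceeds all other entries, so \<open>g = - w\<close>
      off \<open>i\<close>, and the zero sum forces \<open>g i\<close> to be the total of the other
      weights.\<close>
    have "(\<Sum>j\<in>{..<n} - {i}. g j) = (\<Sum>j\<in>{..<n} - {i}. - w j)"
      using g(5) M_diagonal[OF i] True by (intro sum.cong) force+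
    then have "g i = (\<Sum>j<n. w j) - w i"
      using g(2) i sum.remove[of "{..<n}" i g] sum.remove[of "{..<n}" i w] by (simp add: sum_negf)
    then show ?thesis using le g(1)[of i] i by simp
  next
    case False
    then show ?thesis using g(4)[of i] M_diagonal[OF i _ False] k i by force
  qed
  ultimately show ?thesis using that g by auto
qed

text \<open>Around the cycle the differences of \<open>4 f + \<Delta> f\<close> add up to \<open>0\<close>, so none of them
  exceeds the sum of the bounds on the others.\<close>

lemma T_cyclic_triangle:
  assumes i: "i < n" and w: "\<And>j. j < n \<Longrightarrow> 0 \<le> w j"
  shows "2 * T w i \<le> (\<Sum>j<n. T w j)"
proof -
  obtain g where g: "\<And>j. j < n \<Longrightarrow> \<bar>g j\<bar> \<le> w j" "(\<Sum>j<n. g j) = 0" "(\<Sum>j<n. M i j * g j) = T w i"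
    by (rule T_dual_attained[OF i, of w]) (use w in blast)+
  define h where "h l = (\<Sum>j<n. M l j * g j)" for l
  have "(\<Sum>l<n. h l) = (\<Sum>j<n. (\<Sum>l<n. M l j) * g j)"
    unfolding h_def by (subst sum.swap) (simp add: sum_distrib_right)
  also have "\<dots> = 4 * (\<Sum>j<n. g j)" by (simp add: column_sum_M sum_distrib_left)
  finally have h0: "(\<Sum>l<n. h l) = 0" using g(2) by simp
  have "- h l \<le> T w l" for l
    using T_dual_ge[of "\<lambda>j. - g j" w l] g by (simp add: h_def sum_negf)
  then have "(\<Sum>l\<in>{..<n} - {i}. - h l) \<le> (\<Sum>l\<in>{..<n} - {i}. T w l)" by (intro sum_mono)
  then show ?thesis using h0 g(3) i sum.remove[of "{..<n}" i h] sum.remove[of "{..<n}" i "T w"]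
    by (simp add: sum_negf h_def)
qed

text \<open>The choice \<open>k = nx (nx i)\<close>, where row \<open>i\<close> of \<open>M\<close>
  vanishes, bounds \<open>T w i\<close> by a linear form in \<open>w\<close>; the column sums do the
  rest.\<close>

lemma sum_T_le:
  assumes w: "\<And>j. j < n \<Longrightarrow> 0 \<le> w j"
  shows "(\<Sum>i<n. T w i) \<le> 4 * (\<Sum>j<n. w j)"
proof -
  have "T w i \<le> (\<Sum>j<n. M i j * w j)" if i: "i < n" for i
  proof -
    have z: "M i (nx (nx i)) = 0" using neighbours_distinct[OF i] by (simp add: M_def)
    have "(\<Sum>j<n. \<bar>M i j\<bar> * w j) = (\<Sum>j<n. M i j * w j)"
      using M_nonneg[OF i] by (intro sum.cong) auto
    then show ?thesis using T_le[of "nx (nx i)" w i] by (simp add: z)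
  qed
  then have "(\<Sum>i<n. T w i) \<le> (\<Sum>i<n. \<Sum>j<n. M i j * w j)" by (intro sum_mono) auto
  also have "\<dots> = (\<Sum>j<n. (\<Sum>i<n. M i j) * w j)" by (subst sum.swap) (simp add: sum_distrib_right)
  also have "\<dots> = 4 * (\<Sum>j<n. w j)" by (simp add: column_sum_M sum_distrib_left)
  finally show ?thesis .
qed

text \<open>Equality \<open>T u i = T v i\<close> forces \<open>u\<close> and \<open>v\<close> to agree off a level set of row \<open>i\<close> of \<open>M\<close>. These level
  sets are \<open>{i}\<close>, subsets of \<open>{i - 1, i + 1}\<close>, and the complement of \<open>{i - 1, i, i + 1}\<close>.\<close>

lemma T_eq_contact:
  assumes i: "i < n" and le: "\<And>j. j < n \<Longrightarrow> u j \<le> v j" and eq: "u i = v i" "T u i = T v i"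
  shows "(u (pv i) = v (pv i) \<and> u (nx i) = v (nx i)) \<or>
    (\<forall>j<n. j \<noteq> pv i \<longrightarrow> j \<noteq> nx i \<longrightarrow> u j = v j)"
proof -
  obtain k where k: "k < n" "T v i = (\<Sum>j<n. \<bar>M i j - M i k\<bar> * v j)" by (rule T_attained)
  have "(\<Sum>j<n. \<bar>M i j - M i k\<bar> * (v j - u j)) \<le> 0"
    using T_le[OF k(1), of u i] k(2) eq by (simp add: right_diff_distrib sum_subtractf)
  moreover have nn: "\<forall>j\<in>{..<n}. 0 \<le> \<bar>M i j - M i k\<bar> * (v j - u j)" using le by auto
  ultimately have "(\<Sum>j<n. \<bar>M i j - M i k\<bar> * (v j - u j)) = 0"
    by (meson antisym sum_nonneg lessThan_iff)
  then have "\<forall>j\<in>{..<n}. \<bar>M i j - M i k\<bar> * (v j - u j) = 0"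
    using nn by (subst (asm) sum_nonneg_eq_0_iff) auto
  then have agree: "u j = v j" if "j < n" "M i j \<noteq> M i k" for j using that by auto
  consider "k = i" | "k = pv i \<or> k = nx i" | "k \<noteq> i" "k \<noteq> pv i" "k \<noteq> nx i" by blast
  then show ?thesis
  proof cases
    case 1
    then have "u j = v j" if "j < n" for j
      using that agree[OF that] M_diagonal[OF i that] eq(1) by (cases "j = i") auto
    then show ?thesis by simp
  next
    case 2
    then have "M i k > 0" using p_pos(2)[OF i] p_pos(1)[OF nx_less, of i] neighbours_distinct[OF i]
      by (auto simp: M_def)
    then have "u j = v j" if "j < n" "j \<noteq> pv i" "j \<noteq> nx i" for j
      using agree[OF that(1)] that eq(1) by (cases "j = i") (auto simp: M_def)
    then show ?thesis by blast
  next
    case 3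
    then have "M i k = 0" by (simp add: M_def)
    then show ?thesis using agree[of "pv i"] agree[of "nx i"] p_pos(2)[OF i] p_pos(1)[OF nx_less, of i]
        neighbours_distinct[OF i] by (auto simp: M_def)
  qed
qed

section \<open>Spreading of equality sets; positivity, uniqueness and existence of
  eigenvectors\<close>

lemma nx_closed_imp_all:
  assumes "P i" "i < n" "\<And>j. j < n \<Longrightarrow> P j \<Longrightarrow> P (nx j)" "k < n"
  shows "P k"
proof -
  have *: "P ((i + m) mod n)" for m
  proof (induction m)
    case (Suc m)
    have "nx ((i + m) mod n) = (i + Suc m) mod n" by (simp add: nx_def mod_simps)
    then show ?case using assms(3)[of "(i + m) mod n"] Suc n5 by simp
  qed (use assms in simp)
  \<comment> \<open>Adding \<open>n\<close> keeps the subtraction from truncating when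
    \<open>k < i\<close>.\<close>
  have "(i + (k + n - i)) mod n = k" using assms by simp
  then show ?thesis using *[of "k + n - i"] by simp
qed

text \<open>If the second alternative never occurs on \<open>P\<close>, then \<open>P\<close>
  spreads to all vertices along \<open>nx\<close>, and \<open>i\<close> itself serves as
  \<open>l\<close>.\<close>

lemma closed_imp_cofinite:
  assumes "P i" "i < n"
    and "\<And>i. i < n \<Longrightarrow> P i \<Longrightarrow> (P (pv i) \<and> P (nx i)) \<or> (\<forall>j<n. j \<noteq> pv i \<longrightarrow> j \<noteq> nx i \<longrightarrow> P j)"
  obtains l where "l < n" "P l" "\<And>j. j < n \<Longrightarrow> j \<noteq> pv l \<Longrightarrow> j \<noteq> nx l \<Longrightarrow> P j"
proof (cases "\<exists>l<n. P l \<and> (\<forall>j<n. j \<noteq> pv l \<longrightarrow> j \<noteq> nx l \<longrightarrow> P j)")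
  case False
  then have "P j" if "j < n" for j
    using nx_closed_imp_all[of P i j] assms that by blast
  then show ?thesis using that[of i] assms by blast
qed (use that in blast)

text \<open>The zeros of \<open>w\<close> form its equality set with the zero vector, so a single
  zero confines the support to \<open>pv l\<close> and \<open>nx l\<close>. By \<open>adm\<close>
  neither carries more than half of the total, hence both are positive.\<close>

lemma eigenvector_positive:
  assumes w: "\<And>j. j < n \<Longrightarrow> 0 \<le> w j" "(\<Sum>j<n. w j) > 0"
    and adm: "\<And>i. i < n \<Longrightarrow> 2 * w i \<le> (\<Sum>j<n. w j)"
    and eig: "\<And>i. i < n \<Longrightarrow> T w i = \<mu> * w i" and i: "i < n"
  shows "w i > 0"
proof (rule ccontr)
  assume "\<not> w i > 0"
  then have i0: "0 = w i" using w(1)[OF i] by simp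
  have T0: "T (\<lambda>_. 0) j = 0" for j using T_scale[of 0 "\<lambda>_. 0" j] by simp
  have step: "(0 = w (pv i) \<and> 0 = w (nx i)) \<or> (\<forall>j<n. j \<noteq> pv i \<longrightarrow> j \<noteq> nx i \<longrightarrow> 0 = w j)"
    if "i < n" "0 = w i" for i
    using that T_eq_contact[of i "\<lambda>_. 0" w] w(1) eig[of i] T0[of i] by auto
  obtain l where l: "l < n" "0 = w l" "\<And>j. j < n \<Longrightarrow> j \<noteq> pv l \<Longrightarrow> j \<noteq> nx l \<Longrightarrow> 0 = w j"
    using closed_imp_cofinite[of "\<lambda>j. 0 = w j", OF i0 i step] by blast
  note d = neighbours_distinct[OF l(1)]
  have "(\<Sum>j<n. w j) = (\<Sum>j\<in>{pv l, nx l}. w j)"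
    using l(3) by (intro sum.mono_neutral_right) force+
  then have S: "(\<Sum>j<n. w j) = w (pv l) + w (nx l)" using d by simp
  have pos: "w (pv l) > 0" "w (nx l) > 0"
    using adm[of "pv l"] adm[of "nx l"] S w(2) by auto
  \<comment> \<open>At this zero the first alternative of \<open>step\<close> would make
    \<open>w (nx l)\<close> vanish, the second \<open>w (pv l)\<close>.\<close>
  have "0 = w (nx (nx l))" using l(3)[of "nx (nx l)"] d by simp
  then show False using step[of "nx (nx l)"] pos d(6,7) pv_nx[of "nx l"] d(3) by auto
qed

text \<open>At an index where \<open>u / v\<close> is minimal, monotonicity of \<open>T\<close>
  compares the two eigenvalues.\<close>

lemma eigenvalue_le:
  assumes pos: "\<And>j. j < n \<Longrightarrow> 0 < u j" "\<And>j. j < n \<Longrightarrow> 0 < v j"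
    and eig: "\<And>i. i < n \<Longrightarrow> T u i = \<mu> * u i" "\<And>i. i < n \<Longrightarrow> T v i = \<nu> * v i"
  obtains i where "i < n" "\<And>j. j < n \<Longrightarrow> u i / v i * v j \<le> u j" "\<nu> \<le> \<mu>"
proof -
  let ?r = "\<lambda>j. u j / v j"
  have "Min (?r ` {..<n}) \<in> ?r ` {..<n}" using n5 by (intro Min_in) (auto simp: lessThan_empty_iff)
  then obtain i where i: "i < n" "?r i = Min (?r ` {..<n})" by force
  have le: "?r i * v j \<le> u j" if "j < n" for j
  proof -
    have "?r i \<le> ?r j" unfolding i(2) using that by (intro Min_le) auto
    then show ?thesis using pos(2)[OF that] by (simp add: pos_le_divide_eq)
  qed
  have "T (\<lambda>j. ?r i * v j) i \<le> T u i" by (rule T_mono) (use le in auto)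
  then have "?r i * T v i \<le> T u i" using T_scale[of "?r i" v i] pos i(1) by (simp add: less_imp_le)
  then have "\<nu> * u i \<le> \<mu> * u i" using eig[OF i(1)] pos(2)[OF i(1)] by (simp add: mult.commute)
  then show ?thesis using that[OF i(1)] le pos(1)[OF i(1)] by auto
qed

lemma eigenvector_unique:
  assumes pos: "\<And>j. j < n \<Longrightarrow> 0 < u j" "\<And>j. j < n \<Longrightarrow> 0 < v j"
    and eig: "\<And>i. i < n \<Longrightarrow> T u i = \<mu> * u i" "\<And>i. i < n \<Longrightarrow> T v i = \<nu> * v i"
  obtains c where "c > 0" "\<And>j. j < n \<Longrightarrow> v j = c * u j"
proof -
  obtain a where a: "a < n" "\<And>j. j < n \<Longrightarrow> u a / v a * v j \<le> u j" "\<nu> \<le> \<mu>"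
    by (rule eigenvalue_le[of u v \<mu> \<nu>]) (use pos eig in blast)+
  obtain b where b: "b < n" "\<And>j. j < n \<Longrightarrow> v b / u b * u j \<le> v j" "\<mu> \<le> \<nu>"
    by (rule eigenvalue_le[of v u \<nu> \<mu>]) (use pos eig in blast)+
  have \<mu>: "\<mu> = \<nu>" using a b by simp
  have contact: "\<exists>l<n. c * y l = x l \<and> (\<forall>j<n. j \<noteq> pv l \<longrightarrow> j \<noteq> nx l \<longrightarrow> c * y j = x j)"
    if x: "\<And>i. i < n \<Longrightarrow> T x i = \<mu> * x i" and y: "\<And>i. i < n \<Longrightarrow> T y i = \<mu> * y i"
      and c: "0 \<le> c" and le: "\<And>j. j < n \<Longrightarrow> c * y j \<le> x j" and eq: "k < n" "c * y k = x k" for x y c k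
  proof -
    have step: "(c * y (pv i) = x (pv i) \<and> c * y (nx i) = x (nx i)) \<or>
        (\<forall>j<n. j \<noteq> pv i \<longrightarrow> j \<noteq> nx i \<longrightarrow> c * y j = x j)" if "i < n" "c * y i = x i" for i
    proof (rule T_eq_contact)
      have "T (\<lambda>j. c * y j) i = \<mu> * (c * y i)" using T_scale[OF c] y[OF that(1)] by simp
      then show "T (\<lambda>j. c * y j) i = T x i" using that x by simp
    qed (use that le in auto)
    show ?thesis using closed_imp_cofinite[of "\<lambda>j. c * y j = x j", OF eq(2,1) step] by metis
  qed
  define ca cb where "ca = u a / v a" and "cb = v b / u b"
  have "ca > 0" "cb > 0" using pos a(1) b(1) by (auto simp: ca_def cb_def)
  obtain l where l: "l < n" "\<And>j. j < n \<Longrightarrow> j \<noteq> pv l \<Longrightarrow> j \<noteq> nx l \<Longrightarrow> ca * v j = u j"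
    using contact[of u v ca a] eig \<mu> \<open>ca > 0\<close> a pos(2)[OF a(1)] by (auto simp: ca_def)
  obtain m where m: "m < n" "\<And>j. j < n \<Longrightarrow> j \<noteq> pv m \<Longrightarrow> j \<noteq> nx m \<Longrightarrow> cb * u j = v j"
    using contact[of v u cb b] eig \<mu> \<open>cb > 0\<close> b pos(1)[OF b(1)] by (auto simp: cb_def)
  \<comment> \<open>Together the two equality sets have at most four exceptions, so they share a
    vertex.\<close>
  have "card {pv l, nx l, pv m, nx m} \<le> 4" by (auto simp: card_insert_if)
  then have "\<not> {..<n} \<subseteq> {pv l, nx l, pv m, nx m}"
    using card_mono[of "{pv l, nx l, pv m, nx m}" "{..<n}"] n5 by auto
  then obtain j where j: "j < n" "ca * v j = u j" "cb * u j = v j" using l(2) m(2) by auto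
  \<comment> \<open>At a shared vertex the constants are inverse, so the bounds by \<open>ca\<close>
    and \<open>cb\<close> pinch \<open>v\<close> to \<open>cb * u\<close>.\<close>
  then have c1: "ca * cb = 1" using pos(1)[OF j(1)] by (metis less_irrefl mult.assoc mult_cancel_right1)
  have "v j = cb * u j" if "j < n" for j
  proof (rule antisym)
    show "cb * u j \<le> v j" using b(2)[OF that] by (simp add: cb_def)
    have "cb * (ca * v j) \<le> cb * u j"
      using mult_left_mono[OF a(2)[OF that], of cb] \<open>cb > 0\<close> unfolding ca_def by simp
    then show "v j \<le> cb * u j" using c1 by (metis mult.assoc mult.commute mult_1)
  qed
  then show ?thesis using that \<open>cb > 0\<close> by blast
qed

lemma eigenvector_exists:
  obtains w \<mu> where "\<And>j. j < n \<Longrightarrow> 0 < w j" "\<And>i. i < n \<Longrightarrow> 2 * w i \<le> (\<Sum>j<n. w j)"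
    "\<And>i. i < n \<Longrightarrow> T w i = \<mu> * w i"
proof -
  obtain w \<mu> where w: "w \<in> simplex_on n" "1 \<le> \<mu>" "\<And>i. i < n \<Longrightarrow> T w i = \<mu> * w i"
    by (rule monotone_eigenvector[of n T])
       (use n5 T_mono T_scale T_continuous T_one in auto)
  have nn: "0 \<le> w j" for j using w(1) by (simp add: simplex_on_def)
  \<comment> \<open>\<open>T w\<close> obeys the cyclic triangle inequality and equals
    \<open>\<mu> * w\<close> with \<open>\<mu> \<ge> 1\<close>, so \<open>w\<close> obeys it
    too.\<close>
  have adm: "2 * w i \<le> (\<Sum>j<n. w j)" if "i < n" for i
  proof -
    have "\<mu> * (2 * w i) \<le> \<mu> * (\<Sum>j<n. w j)"
      using T_cyclic_triangle[OF that, of w] nn w(3) that by (simp add: sum_distrib_left mult_ac)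
    then show ?thesis using w(2) by simp
  qed
  have "w i > 0" if "i < n" for i
    by (rule eigenvector_positive[OF nn _ adm w(3) that]) (use w(1) in \<open>auto simp: simplex_on_def\<close>)
  then show ?thesis using that adm w(3) by blast
qed

subsection \<open>Path distances and curvature on the cycle\<close>

text \<open>Telescoping along the path. Suitable test functions \<open>f\<close> give the lower
  bounds on path lengths used below.\<close>

lemma path_length_ge:
  assumes f: "\<And>j. j < n \<Longrightarrow> \<bar>f (nx j) - f j\<bar> \<le> e j (nx j)"
    and sym: "\<And>j. j < n \<Longrightarrow> e (nx j) j = e j (nx j)"
    and s: "s \<in> path_lengths {..<n} p e x y"
  shows "\<bar>f y - f x\<bar> \<le> s"
proof -
  obtain u m where u: "s = (\<Sum>k<m. e (u k) (u (Suc k)))" "u 0 = x" "u m = y"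
    "\<And>k. k \<le> m \<Longrightarrow> u k < n" "\<And>k. k < m \<Longrightarrow> adjacent p (u k) (u (Suc k))"
    using s unfolding path_lengths_def by auto
  have "\<bar>f (u (Suc k)) - f (u k)\<bar> \<le> e (u k) (u (Suc k))" if "k < m" for k
  proof -
    have k: "u k < n" "u (Suc k) < n" using u(4) that by auto
    from adjacent_iff[OF this] u(5)[OF that]
    consider "u (Suc k) = nx (u k)" | "u k = nx (u (Suc k))" by blast
    then show ?thesis
      by cases (use f[of "u k"] f[of "u (Suc k)"] sym[of "u (Suc k)"] k in \<open>auto simp: abs_minus_commute\<close>)
  qed
  then have "(\<Sum>k<m. \<bar>f (u (Suc k)) - f (u k)\<bar>) \<le> s" unfolding u(1) by (intro sum_mono) auto
  moreover have "f y - f x = (\<Sum>k<m. f (u (Suc k)) - f (u k))"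
    using sum_lessThan_telescope[of "\<lambda>k. f (u k)" m] u(2,3) by simp
  ultimately show ?thesis using sum_abs[of "\<lambda>k. f (u (Suc k)) - f (u k)" "{..<m}"] by linarith
qed

text \<open>Used with \<open>m = 0\<close> (trivial path), \<open>m = 1\<close> (an edge),
  \<open>m = n - 1\<close> (the long way round an edge) and \<open>m = y + n - x\<close>
  (connectedness).\<close>

lemma forward_path:
  assumes "x < n"
  shows "(\<Sum>k<m. e ((x + k) mod n) (nx ((x + k) mod n))) \<in> path_lengths {..<n} p e x ((x + m) mod n)"
proof -
  let ?u = "\<lambda>k. (x + k) mod n"
  have nx: "nx (?u k) = ?u (Suc k)" for k by (simp add: nx_def mod_simps)
  have less: "?u k < n" for k using n5 by simp
  have "adjacent p (?u k) (?u (Suc k))" for k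
    using adjacent_iff[OF less less, of k "Suc k"] nx[of k] by simp
  then show ?thesis unfolding path_lengths_def
    using less assms by (auto simp: nx intro!: exI[of _ ?u] exI[of _ m])
qed

lemma path_lengths_nonempty: "x < n \<Longrightarrow> y < n \<Longrightarrow> path_lengths {..<n} p e x y \<noteq> {}"
  using forward_path[of x e "y + n - x"] by auto

lemma path_lengths_scale:
  assumes "\<And>j. j < n \<Longrightarrow> e' j (nx j) = c * e j (nx j)" "\<And>j. j < n \<Longrightarrow> e' (nx j) j = c * e (nx j) j"
    and s: "s \<in> path_lengths {..<n} p e x y"
  shows "c * s \<in> path_lengths {..<n} p e' x y"
proof -
  obtain u m where u: "s = (\<Sum>k<m. e (u k) (u (Suc k)))" "u 0 = x" "u m = y"
    "\<And>k. k \<le> m \<Longrightarrow> u k < n" "\<And>k. k < m \<Longrightarrow> adjacent p (u k) (u (Suc k))"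
    using s unfolding path_lengths_def by auto
  have "e' (u k) (u (Suc k)) = c * e (u k) (u (Suc k))" if "k < m" for k
  proof -
    have k: "u k < n" "u (Suc k) < n" using u(4) that by auto
    from adjacent_iff[OF this] u(5)[OF that]
    consider "u (Suc k) = nx (u k)" | "u k = nx (u (Suc k))" by blast
    then show ?thesis by cases (use assms k in simp_all)
  qed
  then have "c * s = (\<Sum>k<m. e' (u k) (u (Suc k)))" unfolding u(1) by (simp add: sum_distrib_left)
  then show ?thesis unfolding path_lengths_def using u by (auto intro!: exI[of _ u] exI[of _ m])
qed

lemma path_lengths_cong:
  assumes "\<And>j. j < n \<Longrightarrow> e' j (nx j) = e j (nx j)" "\<And>j. j < n \<Longrightarrow> e' (nx j) j = e (nx j) j"
  shows "path_lengths {..<n} p e' x y = path_lengths {..<n} p e x y"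
  using path_lengths_scale[of e' 1 e] path_lengths_scale[of e 1 e'] assms by auto

lemma path_lengths_reverse:
  assumes sym: "\<And>j. j < n \<Longrightarrow> e (nx j) j = e j (nx j)"
    and s: "s \<in> path_lengths {..<n} p e x y"
  shows "s \<in> path_lengths {..<n} p e y x"
proof -
  obtain u m where u: "s = (\<Sum>k<m. e (u k) (u (Suc k)))" "u 0 = x" "u m = y"
    "\<And>k. k \<le> m \<Longrightarrow> u k < n" "\<And>k. k < m \<Longrightarrow> adjacent p (u k) (u (Suc k))"
    using s unfolding path_lengths_def by auto
  have rev: "adjacent p (u (Suc k)) (u k) \<and> e (u (Suc k)) (u k) = e (u k) (u (Suc k))" if "k < m" for k
  proof -
    have k: "u k < n" "u (Suc k) < n" using u(4) that by auto
    from adjacent_iff[OF this] u(5)[OF that]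
    consider "u (Suc k) = nx (u k)" | "u k = nx (u (Suc k))" by blast
    then show ?thesis using adjacent_iff[OF k(2,1)]
      by cases (use sym[of "u k"] sym[of "u (Suc k)"] k in simp_all)
  qed
  have Suc_diff: "m - k = Suc (m - Suc k)" if "k < m" for k using that by simp
  have "s = (\<Sum>k<m. e (u (m - Suc k)) (u (Suc (m - Suc k))))"
    unfolding u(1) by (rule sum.nat_diff_reindex[symmetric])
  also have "\<dots> = (\<Sum>k<m. e (u (m - k)) (u (m - Suc k)))"
    by (rule sum.cong) (use rev Suc_diff in auto)
  finally have "s = (\<Sum>k<m. e (u (m - k)) (u (m - Suc k)))" .
  moreover have "adjacent p (u (m - k)) (u (m - Suc k))" if "k < m" for k
    using rev[of "m - Suc k"] that Suc_diff[OF that] by simp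
  ultimately show ?thesis unfolding path_lengths_def using u
    by (auto intro!: exI[of _ "\<lambda>k. u (m - k)"] exI[of _ m])
qed

lemma sum_differences: "(\<Sum>j<n. f (nx j) - f j) = (0::real)"
  using sum_shift[of f 1] by (simp add: sum_subtractf nx_def)

text \<open>Discrete integration by partial sums; the zero total closes the edge from
  \<open>n - 1\<close> back to 0.\<close>

lemma differences_exist:
  assumes "(\<Sum>j<n. g j) = (0::real)"
  obtains f where "\<And>j. j < n \<Longrightarrow> f (nx j) - f j = g j"
proof -
  obtain l where l: "n = Suc l" using n5 by (cases n) auto
  have "(\<Sum>k<nx j. g k) - (\<Sum>k<j. g k) = g j" if "j < n" for j
  proof -
    have "nx j = (if j = l then 0 else Suc j)" using nx_if[OF that] l by auto
    moreover have "(\<Sum>k<l. g k) + g l = 0" using assms unfolding l by simp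
    ultimately show ?thesis by (cases "j = l") auto
  qed
  then show ?thesis using that[of "\<lambda>j. \<Sum>k<j. g k"] by blast
qed

section \<open>Edge weights and curvature of a fixed path distance\<close>

context
  fixes d
  assumes D: "general_path_distance {..<n} p d"
begin

lemma d_basic:
  assumes "x < n" "y < n"
  shows "0 \<le> d x y" "d x y = d y x" "d x y = 0 \<longleftrightarrow> x = y" "d x y = Inf (path_lengths {..<n} p d x y)"
  using D assms unfolding general_path_distance_def by blast+

lemma d_pos: "x < n \<Longrightarrow> y < n \<Longrightarrow> x \<noteq> y \<Longrightarrow> 0 < d x y"
  using d_basic(1,3)[of x y] by linarith

lemma d_edge_pos: "j < n \<Longrightarrow> 0 < d j (nx j)"
  using neighbours_distinct(1)[of j] by (intro d_pos) auto

lemma d_le_path: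
  assumes "x < n" "y < n" "s \<in> path_lengths {..<n} p d x y"
  shows "d x y \<le> s"
proof -
  have "0 \<le> t" if "t \<in> path_lengths {..<n} p d x y" for t
  proof -
    \<comment> \<open>The zero test function shows that path lengths are nonnegative, so that their
      \<open>Inf\<close> is a genuine lower bound.\<close>
    have "\<bar>(0::real) - 0\<bar> \<le> t"
      by (rule path_length_ge[OF _ _ that]) (simp_all add: d_basic(1) d_basic(2)[OF nx_less])
    then show ?thesis by simp
  qed
  then have "bdd_below (path_lengths {..<n} p d x y)" by (rule bdd_belowI)
  then show ?thesis using cInf_lower[OF assms(3)] d_basic(4)[OF assms(1,2)] by simp
qed

lemma d_scale_le:
  assumes D': "general_path_distance {..<n} p d'" and c: "c > 0"
    and e: "\<And>j. j < n \<Longrightarrow> d j (nx j) = c * d' j (nx j)" and xy: "x < n" "y < n"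
  shows "d x y \<le> c * d' x y"
proof -
  have sym: "d' (nx j) j = d' j (nx j)" if "j < n" for j
    using D' that unfolding general_path_distance_def by auto
  have "d x y / c \<le> s" if "s \<in> path_lengths {..<n} p d' x y" for s
  proof -
    have "c * s \<in> path_lengths {..<n} p d x y"
      by (rule path_lengths_scale[OF _ _ that]) (use e sym d_basic(2)[OF nx_less] in auto)
    then show ?thesis using d_le_path[OF xy] c by (simp add: divide_simps mult.commute)
  qed
  then have "d x y / c \<le> Inf (path_lengths {..<n} p d' x y)"
    using path_lengths_nonempty[OF xy] by (intro cInf_greatest) auto
  then have "d x y / c \<le> d' x y" using D' xy unfolding general_path_distance_def by auto
  then show ?thesis using c by (simp add: divide_simps mult.commute)
qed

text \<open>The complementary arc of \<open>n - 1\<close> edges also joins the ends of the edge, and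
  no path is shorter than the distance.\<close>

lemma d_admissible:
  assumes i: "i < n"
  shows "2 * d i (nx i) \<le> (\<Sum>j<n. d j (nx j))"
proof -
  obtain l where l: "n = Suc l" using n5 by (cases n) auto
  have end_eq: "(nx i + l) mod n = i"
  proof -
    have "(nx i + l) mod n = (i + 1 + l) mod n" by (simp add: nx_def mod_simps)
    also have "i + 1 + l = i + n" using l by simp
    finally show ?thesis using i by simp
  qed
  have "d (nx i) i \<le> (\<Sum>k<l. d ((nx i + k) mod n) (nx ((nx i + k) mod n)))"
    using forward_path[of "nx i" d l] d_le_path[of "nx i" i] i end_eq by simp
  moreover have "(\<Sum>k<l. d ((nx i + k) mod n) (nx ((nx i + k) mod n))) + d i (nx i) = (\<Sum>j<n. d j (nx j))"
  proof -
    have "(\<Sum>k<n. h k) = (\<Sum>k<l. h k) + h l" for h :: "nat \<Rightarrow> real" unfolding l by simp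
    then show ?thesis using sum_shift[of "\<lambda>j. d j (nx j)" "nx i"] end_eq by simp
  qed
  ultimately show ?thesis using d_basic(2)[of "nx i" i] i by simp
qed

lemma lipschitz_iff:
  "(\<forall>u<n. \<forall>v<n. \<bar>f u - f v\<bar> \<le> d u v) \<longleftrightarrow> (\<forall>j<n. \<bar>f (nx j) - f j\<bar> \<le> d j (nx j))"
proof (intro iffI allI impI)
  fix u v assume f: "\<forall>j<n. \<bar>f (nx j) - f j\<bar> \<le> d j (nx j)" and uv: "u < n" "v < n"
  have "\<bar>f v - f u\<bar> \<le> s" if "s \<in> path_lengths {..<n} p d u v" for s
    by (rule path_length_ge[OF _ _ that]) (use f d_basic(2) in auto)
  then show "\<bar>f u - f v\<bar> \<le> d u v"
    unfolding d_basic(4)[OF uv] using path_lengths_nonempty[OF uv]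
    by (intro cInf_greatest) (auto simp: abs_minus_commute)
next
  fix j assume "\<forall>u<n. \<forall>v<n. \<bar>f u - f v\<bar> \<le> d u v" "j < n"
  then have "\<bar>f (nx j) - f j\<bar> \<le> d (nx j) j" by simp
  then show "\<bar>f (nx j) - f j\<bar> \<le> d j (nx j)" using d_basic(2)[of "nx j" j] \<open>j < n\<close> by simp
qed

text \<open>The pair \<open>nx i\<close>, \<open>i\<close> already contributes the value 1 to a
  finite set, so the supremum is 1 exactly when nothing exceeds 1; by \<open>lipschitz_iff\<close>
  this need only be checked on edges.\<close>

lemma Sup_gradient_iff:
  assumes i: "i < n" and f: "gradient d (nx i) i f = 1"
  shows "Sup {\<bar>gradient d u v f\<bar> | u v. u \<in> {..<n} \<and> v \<in> {..<n} \<and> u \<noteq> v} = 1 \<longleftrightarrow>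
    (\<forall>j<n. \<bar>f (nx j) - f j\<bar> \<le> d j (nx j))"
proof -
  let ?S = "{\<bar>gradient d u v f\<bar> | u v. u \<in> {..<n} \<and> v \<in> {..<n} \<and> u \<noteq> v}"
  have "?S \<subseteq> (\<lambda>(u, v). \<bar>gradient d u v f\<bar>) ` ({..<n} \<times> {..<n})" by auto
  then have fin: "finite ?S" by (rule finite_subset) simp
  have one: "1 \<in> ?S"
    by (rule CollectI, rule exI[of _ "nx i"], rule exI[of _ i])
       (use f i neighbours_distinct(1)[OF i] in simp)
  have grad: "\<bar>gradient d u v f\<bar> \<le> 1 \<longleftrightarrow> \<bar>f u - f v\<bar> \<le> d u v" if "u < n" "v < n" "u \<noteq> v" for u v
  proof -
    have "d u v > 0" using that by (rule d_pos)
    then show ?thesis by (simp add: gradient_def divide_simps abs_divide)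
  qed
  have "Sup ?S = 1 \<longleftrightarrow> (\<forall>s\<in>?S. s \<le> 1)"
  proof
    assume "Sup ?S = 1"
    then show "\<forall>s\<in>?S. s \<le> 1" using cSup_upper[OF _ bdd_above_finite[OF fin]] by fastforce
  next
    assume "\<forall>s\<in>?S. s \<le> 1"
    then show "Sup ?S = 1" by (intro cSup_eq_maximum[OF one]) blast
  qed
  also have "\<dots> \<longleftrightarrow> (\<forall>u<n. \<forall>v<n. u \<noteq> v \<longrightarrow> \<bar>f u - f v\<bar> \<le> d u v)"
    unfolding lessThan_iff using grad by blast
  also have "\<dots> \<longleftrightarrow> (\<forall>u<n. \<forall>v<n. \<bar>f u - f v\<bar> \<le> d u v)"
  proof -
    have "\<bar>f u - f u\<bar> \<le> d u u" if "u < n" for u using d_basic(1)[OF that that] by simp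
    then show ?thesis by blast
  qed
  finally show ?thesis unfolding lipschitz_iff .
qed

text \<open>With the difference across edge \<open>i\<close> fixed at its weight, minimising the
  gradient of the Laplacian means maximising row \<open>i\<close> of \<open>M\<close> against the
  differences of \<open>f\<close>.\<close>

lemma curvature_eq:
  assumes i: "i < n"
  shows "ollivier_curvature {..<n} p d i (nx i) = 4 - T (\<lambda>j. d j (nx j)) i / d i (nx i)"
proof -
  let ?w = "\<lambda>j. d j (nx j)"
  have w: "?w i > 0" "d (nx i) i = ?w i" using d_edge_pos[OF i] d_basic(2)[OF nx_less i] by auto
  have grad: "gradient d i (nx i) (laplacian {..<n} p f) = 4 - (\<Sum>j<n. M i j * (f (nx j) - f j)) / ?w i"
    if "f (nx i) - f i = ?w i" for f
    unfolding sum_M_differences[OF i] that gradient_def using w by (simp add: field_simps)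
  have feas: "(gradient d (nx i) i f = 1 \<and>
      Sup {\<bar>gradient d u v f\<bar> | u v. u \<in> {..<n} \<and> v \<in> {..<n} \<and> u \<noteq> v} = 1) \<longleftrightarrow>
      f (nx i) - f i = ?w i \<and> (\<forall>j<n. \<bar>f (nx j) - f j\<bar> \<le> ?w j)" for f
  proof -
    have "gradient d (nx i) i f = 1 \<longleftrightarrow> f (nx i) - f i = ?w i"
      using w by (auto simp: gradient_def divide_simps)
    then show ?thesis using Sup_gradient_iff[OF i] by blast
  qed
  show ?thesis unfolding ollivier_curvature_def feas
  proof (rule cInf_eq_minimum)
    obtain g where g: "\<And>j. j < n \<Longrightarrow> \<bar>g j\<bar> \<le> ?w j" "(\<Sum>j<n. g j) = 0" "(\<Sum>j<n. M i j * g j) = T ?w i"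
      "2 * ?w i \<le> (\<Sum>j<n. ?w j) \<Longrightarrow> g i = ?w i"
      by (rule T_dual_attained[OF i, of ?w]) (use d_basic(1)[OF _ nx_less] in blast)+
    obtain f where f: "\<And>j. j < n \<Longrightarrow> f (nx j) - f j = g j" using differences_exist[OF g(2)] by blast
    \<comment> \<open>By admissibility the optimum for \<open>T\<close> meets the side condition at
      edge \<open>i\<close>, so the infimum is attained.\<close>
    have "f (nx i) - f i = ?w i" using g(4)[OF d_admissible[OF i]] f[OF i] by simp
    moreover have "(\<Sum>j<n. M i j * (f (nx j) - f j)) = T ?w i" using f g(3) by simp
    ultimately show "4 - T ?w i / ?w i \<in> {gradient d i (nx i) (laplacian {..<n} p f) | f.
        f (nx i) - f i = ?w i \<and> (\<forall>j<n. \<bar>f (nx j) - f j\<bar> \<le> ?w j)}"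
      using f g(1) grad[of f] by (auto intro!: exI[of _ f])
  next
    fix z assume "z \<in> {gradient d i (nx i) (laplacian {..<n} p f) | f.
        f (nx i) - f i = ?w i \<and> (\<forall>j<n. \<bar>f (nx j) - f j\<bar> \<le> ?w j)}"
    then obtain f where f: "f (nx i) - f i = ?w i" "\<forall>j<n. \<bar>f (nx j) - f j\<bar> \<le> ?w j"
      and z: "z = gradient d i (nx i) (laplacian {..<n} p f)" by blast
    have "(\<Sum>j<n. M i j * (f (nx j) - f j)) \<le> T ?w i"
      by (rule T_dual_ge) (use f sum_differences in auto)
    then show "4 - T ?w i / ?w i \<le> z" unfolding z grad[OF f(1)] using w by (simp add: divide_right_mono)
  qed
qed

lemma constant_curvature_iff:
  "(\<forall>i<n. ollivier_curvature {..<n} p d i ((i + 1) mod n) = K) \<longleftrightarrow>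
   (\<forall>i<n. T (\<lambda>j. d j (nx j)) i = (4 - K) * d i (nx i))"
proof -
  have "ollivier_curvature {..<n} p d i ((i + 1) mod n) = K \<longleftrightarrow> T (\<lambda>j. d j (nx j)) i = (4 - K) * d i (nx i)"
    if "i < n" for i
    unfolding nx_def[symmetric] curvature_eq[OF that] using d_edge_pos[OF that]
    by (auto simp: field_simps)
  then show ?thesis by blast
qed

text \<open>Summing the eigenvector equation over \<open>i\<close> and using \<open>sum_T_le\<close>
  gives \<open>4 - K \<le> 4\<close>.\<close>

lemma constant_curvature_nonneg:
  assumes "\<And>i. i < n \<Longrightarrow> T (\<lambda>j. d j (nx j)) i = (4 - K) * d i (nx i)"
  shows "0 \<le> K"
proof -
  let ?L = "\<Sum>j<n. d j (nx j)"
  have "(4 - K) * ?L \<le> 4 * ?L"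
    using sum_T_le[of "\<lambda>j. d j (nx j)"] d_basic(1)[OF _ nx_less] assms by (simp add: sum_distrib_left)
  moreover have "?L > 0" using d_edge_pos n5 by (intro sum_pos) (auto simp: lessThan_empty_iff)
  ultimately show ?thesis by (simp add: algebra_simps zero_le_mult_iff)
qed

end

text \<open>Converse to \<open>d_admissible\<close>: the shortest path metric of the weights works
  once each edge is seen to be a shortest path between its ends.\<close>

lemma path_distance_of_weights:
  assumes w: "\<And>j. j < n \<Longrightarrow> 0 < w j" and adm: "\<And>i. i < n \<Longrightarrow> 2 * w i \<le> (\<Sum>j<n. w j)"
  obtains d where "general_path_distance {..<n} p d" "\<And>j. j < n \<Longrightarrow> d j (nx j) = w j"
proof -
  define e where "e x y = (if y = nx x then w x else w y)" for x y
  have e: "e j (nx j) = w j" "e (nx j) j = w j" if "j < n" for j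
    using neighbours_distinct[OF that] by (auto simp: e_def)
  define d where "d x y = Inf (path_lengths {..<n} p e x y)" for x y
  have ge: "\<bar>f y - f x\<bar> \<le> s" if "\<And>j. j < n \<Longrightarrow> \<bar>f (nx j) - f j\<bar> \<le> w j" "s \<in> path_lengths {..<n} p e x y"
    for f x y s by (rule path_length_ge[OF _ _ that(2)]) (use that e in auto)
  have d_ge: "\<bar>f y - f x\<bar> \<le> d x y" if "\<And>j. j < n \<Longrightarrow> \<bar>f (nx j) - f j\<bar> \<le> w j" "x < n" "y < n"
    for f x y unfolding d_def using path_lengths_nonempty[OF that(2,3)] ge[OF that(1)]
    by (intro cInf_greatest) auto
  have d_le: "d x y \<le> s" if "s \<in> path_lengths {..<n} p e x y" for x y s
    unfolding d_def
    by (rule cInf_lower[OF that], rule bdd_belowI[of _ 0]) (use ge[of "\<lambda>_. 0"] w in \<open>auto simp: less_imp_le\<close>)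
  have sym: "d x y = d y x" for x y
  proof -
    have "path_lengths {..<n} p e x y = path_lengths {..<n} p e y x"
      using path_lengths_reverse[of e] e by auto
    then show ?thesis by (simp add: d_def)
  qed
  have d_edge: "d i (nx i) = w i" if i: "i < n" for i
  proof (rule antisym)
    show "d i (nx i) \<le> w i"
      using d_le[of "w i" i "nx i"] forward_path[OF i, of e 1] e[OF i] i by (simp add: nx_def)
    \<comment> \<open>A 1-Lipschitz \<open>f\<close> with \<open>f (nx i) - f i = w i\<close> shows that no detour is shorter than the edge.\<close>
    define t where "t = w i / ((\<Sum>j<n. w j) - w i)"
    define g where "g j = (if j = i then w i else - (t * w j))" for j
    have pos: "(\<Sum>j<n. w j) - w i > 0" using adm[OF i] w[OF i] by linarith
    \<comment> \<open>The drop compensating \<open>w i\<close> is spread over the other edges in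
      proportion to their weights; \<open>t \<le> 1\<close> comes from \<open>adm\<close>.\<close>
    have t: "0 \<le> t" "t \<le> 1" using pos adm[OF i] w[OF i] by (auto simp: t_def divide_simps)
    have rest: "(\<Sum>j\<in>{..<n} - {i}. w j) = (\<Sum>j<n. w j) - w i"
      using i sum.remove[of "{..<n}" i w] by simp
    have "(\<Sum>j<n. g j) = w i + (\<Sum>j\<in>{..<n} - {i}. - (t * w j))"
      using i by (subst sum.remove[of _ i]) (auto simp: g_def intro!: sum.cong)
    also have "\<dots> = 0"
      using pos by (simp add: sum_negf sum_distrib_left[symmetric] rest) (simp add: t_def)
    finally have g0: "(\<Sum>j<n. g j) = 0" .
    obtain f where f: "\<And>j. j < n \<Longrightarrow> f (nx j) - f j = g j" using differences_exist[OF g0] by blast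
    have "\<bar>g j\<bar> \<le> w j" if "j < n" for j
      using t w[OF that] w[OF i] mult_right_mono[OF t(2), of "w j"] by (auto simp: g_def abs_mult)
    then have "\<bar>f (nx i) - f i\<bar> \<le> d i (nx i)" using f i by (intro d_ge) auto
    then show "w i \<le> d i (nx i)" using f[OF i] w[OF i] by (simp add: g_def)
  qed
  have nonneg: "0 \<le> d x y" if "x < n" "y < n" for x y
    using d_ge[of "\<lambda>_. 0" x y] that w by (auto simp: less_imp_le)
  have zero: "d x y = 0 \<longleftrightarrow> x = y" if xy: "x < n" "y < n" for x y
  proof
    assume "x = y"
    then show "d x y = 0"
      using d_le[of 0 x x] forward_path[OF xy(1), of e 0] nonneg[OF xy] xy by simp
  next
    assume d0: "d x y = 0"
    define \<delta> where "\<delta> = Min (w ` {..<n})"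
    have "\<delta> > 0" unfolding \<delta>_def using w n5 by (subst Min_gr_iff) (auto simp: lessThan_empty_iff)
    have \<delta>: "\<delta> \<le> w j" if "j < n" for j unfolding \<delta>_def using that by (intro Min_le) auto
    \<comment> \<open>A bump at \<open>x\<close> as high as the smallest weight is a valid test
      function and separates \<open>x\<close> from every other vertex.\<close>
    define f where "f v = (if v = x then \<delta> else 0)" for v
    have "\<bar>f y - f x\<bar> \<le> d x y"
      by (rule d_ge) (use \<delta> w xy \<open>\<delta> > 0\<close> in \<open>auto simp: f_def less_imp_le\<close>)
    then show "x = y" using d0 \<open>\<delta> > 0\<close> by (auto simp: f_def split: if_splits)
  qed
  \<comment> \<open>As \<open>d\<close> and \<open>e\<close> agree on edges, \<open>d\<close> is the
    infimum of its own path lengths.\<close>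
  have "path_lengths {..<n} p d x y = path_lengths {..<n} p e x y" for x y
    by (rule path_lengths_cong) (use d_edge e sym[of "nx _" _] in simp_all)
  then have "general_path_distance {..<n} p d"
    unfolding general_path_distance_def using nonneg sym zero by (auto simp: d_def)
  then show ?thesis using that d_edge by blast
qed

section \<open>Existence and uniqueness of the distance of constant curvature\<close>

lemma constant_curvature_distance_exists: "\<exists>d. constant_curvature_distance n p d"
proof -
  obtain w \<mu> where w: "\<And>j. j < n \<Longrightarrow> 0 < w j" "\<And>i. i < n \<Longrightarrow> 2 * w i \<le> (\<Sum>j<n. w j)"
    "\<And>i. i < n \<Longrightarrow> T w i = \<mu> * w i" by (rule eigenvector_exists) blast
  obtain d where d: "general_path_distance {..<n} p d" "\<And>j. j < n \<Longrightarrow> d j (nx j) = w j"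
    using path_distance_of_weights[of w] w(1,2) by blast
  have "T (\<lambda>j. d j (nx j)) i = T w i" for i
    using d(2) by (intro antisym T_mono) auto
  then have "\<forall>i<n. ollivier_curvature {..<n} p d i ((i + 1) mod n) = 4 - \<mu>"
    unfolding constant_curvature_iff[OF d(1)] using w(3) d(2) by simp
  then show ?thesis using d(1) unfolding constant_curvature_distance_def by blast
qed

lemma constant_curvature_distance_unique:
  assumes "constant_curvature_distance n p d" "constant_curvature_distance n p d'"
  shows "\<exists>c>0. \<forall>x<n. \<forall>y<n. d' x y = c * d x y"
proof -
  obtain K K' where D: "general_path_distance {..<n} p d" "general_path_distance {..<n} p d'"
    and K: "\<forall>i<n. ollivier_curvature {..<n} p d i ((i + 1) mod n) = K"
      "\<forall>i<n. ollivier_curvature {..<n} p d' i ((i + 1) mod n) = K'"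
    using assms unfolding constant_curvature_distance_def by blast
  note eig = K(1)[unfolded constant_curvature_iff[OF D(1)]] K(2)[unfolded constant_curvature_iff[OF D(2)]]
  obtain c where c: "c > 0" "\<And>j. j < n \<Longrightarrow> d' j (nx j) = c * d j (nx j)"
    using eigenvector_unique[of "\<lambda>j. d j (nx j)" "\<lambda>j. d' j (nx j)" "4 - K" "4 - K'"]
      eig d_edge_pos[OF D(1)] d_edge_pos[OF D(2)] by blast
  have "d' x y = c * d x y" if xy: "x < n" "y < n" for x y
  proof (rule antisym)
    show "d' x y \<le> c * d x y" by (rule d_scale_le[OF D(2) D(1) c(1) c(2) xy])
    have "d x y \<le> (1 / c) * d' x y"
      by (rule d_scale_le[OF D(1) D(2) _ _ xy]) (use c in auto)
    then show "c * d x y \<le> d' x y" using c(1) by (simp add: field_simps)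
  qed
  then show ?thesis using c(1) by blast
qed

end

theorem theorem6p3:
  fixes n :: nat and p :: "nat \<Rightarrow> nat \<Rightarrow> real"
  assumes "n \<ge> 5"
    and "markov_kernel {..<n} p"
    and "\<And>i j. i < n \<Longrightarrow> j < n \<Longrightarrow>
           p i j > 0 \<longleftrightarrow> j \<in> {(i + 1) mod n, (i + n - 1) mod n}"
  shows "(\<exists>d. constant_curvature_distance n p d) \<and>
         (\<forall>d d'. constant_curvature_distance n p d \<and> constant_curvature_distance n p d' \<longrightarrow>
            (\<exists>c>0. \<forall>x<n. \<forall>y<n. d' x y = c * d x y)) \<and>
         (\<forall>d. constant_curvature_distance n p d \<longrightarrow>
            (\<forall>i<n. ollivier_curvature {..<n} p d i ((i + 1) mod n) \<ge> 0))"
proof -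
  interpret cyclic_walk n p using assms by unfold_locales
  have "0 \<le> ollivier_curvature {..<n} p d i ((i + 1) mod n)"
    if d: "constant_curvature_distance n p d" and i: "i < n" for d i
  proof -
    obtain K where D: "general_path_distance {..<n} p d"
      and K: "\<forall>i<n. ollivier_curvature {..<n} p d i ((i + 1) mod n) = K"
      using d unfolding constant_curvature_distance_def by blast
    have "0 \<le> K" using constant_curvature_nonneg[OF D] K[unfolded constant_curvature_iff[OF D]] by blast
    then show ?thesis using K i by simp
  qed
  then show ?thesis
    using constant_curvature_distance_exists constant_curvature_distance_unique by blast
qed

end
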